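(* Let $G$ be a groupoid over $M$ in a tangent category, let $\pi:A\to M$ with anchor $\varrho$ be its associated anchored bundle, and for $(v,w)\in A\times_{\varrho,T(\pi)}T(A)$ let $$\alpha(v,w)=cw\circ 0v\circ(c0pw)^{-1}\in T^2(G).$$ Then $\alpha$ takes values in $T(A)$, i.e. $\alpha:A\times_{\varrho,T(\pi)}T(A)\to T^2(G)$ factors through $T(A)\rightarrowtail T^2(G)$.
   Context: Conventions: composition of arrows is juxtaposition in applicative order ($gf$: first $f$, then $g$); subscripts of natural transformations are omitted; equations may be read on generalised elements. An additive bundle over $M$ is a commutative monoid in the slice category over $M$: an arrow $q:E\to M$, zero $\xi:M\to E$, addition $+_q$. A morphism is a commuting square preserving zero and addition. A tangent category is a category with an endofunctor $T$ and natural transformations $p:T\Rightarrow\mathrm{id}$, $0:\mathrm{id}\Rightarrow T$, $+:T\times_{p,p}T\Rightarrow T$, $l:T\Rightarrow T^2$, $c:T^2\Rightarrow T^2$ such that: pullback powers of $p$ exist and are preserved by $T$; each $(p_M,0_M,+_M)$ is an additive bundle; $(l,0):p\Rightarrow T(p)$ and $(c,\mathrm{id}):T(p)\Rightarrow p$ are additive bundle morphisms; $cc=\mathrm{id}$, $T(c)cT(c)=cT(c)c$, $cl=l$, $T(l)l=ll$, $cT(c)l=T(l)c$; and $\mu(a,b)=T(+)(0b,la)$, $T(M)\times_MT(M)\to T^2(M)$, is an equaliser of $T(p)$ and $0pp$. Standing assumptions: negatives (additive bundles are commutative groups in the slice) and all limits used exist and are preserved by $T$. The groupoid $G$ has identity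 $e:M\to G$, source and target $s,t:G\to M$, inverse $(-)^{-1}$; $g\circ h$ is defined when $s(g)=t(h)$. In $T^2(G)$, $\circ$ and $(-)^{-1}$ denote the operations obtained by applying $T^2$, so $g\circ h$ is defined when $T^2(s)g=T^2(t)h$. Associated anchored bundle: $A$ is the pullback of $(p,T(s)):T(G)\to G\times T(M)$ along $(e,0):M\to G\times T(M)$, with projection $\pi:A\to M$ and monomorphism $\iota:A\rightarrowtail T(G)$. Thus elements of $A$ are $v\in T(G)$ with $pv=em$, $T(s)v=0m$, where $m=\pi v$; elements of $T(A)$ are regarded as elements $w\in T^2(G)$ with $T(p)w=T(e)T(\pi)w$ and $T^2(s)w=T(0)T(\pi)w$. Zero section, addition and lift are inherited from $(T(G),p)$: $\xi=0e$, $\lambda v=lv$. The anchor is $\varrho=T(t)\iota:A\to T(M)$. The prolongation $A\times_{\varrho,T(\pi)}T(A)$ is the pullback of $\varrho$ and $T(\pi):T(A)\to T(M)$: pairs $(v,w)$ with $\varrho v=T(\pi)w$. The composite defining $\alpha(v,w)$ is then defined in $T^2(G)$. *)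

theory Defs
  imports Main
begin

section \<open>Categories and limits\<close>

record ('o, 'a) category =
  Ob :: "'o set"
  Ar :: "'a set"
  Dom :: "'a \<Rightarrow> 'o"
  Cod :: "'a \<Rightarrow> 'o"
  Idt :: "'o \<Rightarrow> 'a" (\<open>\<one>\<index>\<close>)
  Comp :: "'a \<Rightarrow> 'a \<Rightarrow> 'a" (infixr \<open>\<cdot>\<index>\<close> 70)

definition in_hom ::
    "('o, 'a, 'z) category_scheme \<Rightarrow> 'a \<Rightarrow> 'o \<Rightarrow> 'o \<Rightarrow> bool"
    (\<open>(\<guillemotleft>_ : _ \<rightarrow>\<index> _\<guillemotright>)\<close>) where
  "in_hom C f X Y \<longleftrightarrow> f \<in> Ar C \<and> Dom C f = X \<and> Cod C f = Y"

text \<open>The composite \<open>g \<cdot> f\<close> is in applicative order (first \<open>f\<close>, then \<open>g\<close>); its value is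
  unspecified when \<open>Dom g \<noteq> Cod f\<close>.\<close>

locale category =
  fixes C :: "('o, 'a, 'z) category_scheme" (structure)
  assumes dom_in: "f \<in> Ar C \<Longrightarrow> Dom C f \<in> Ob C"
    and cod_in: "f \<in> Ar C \<Longrightarrow> Cod C f \<in> Ob C"
    and id_hom: "X \<in> Ob C \<Longrightarrow> \<guillemotleft>\<one> X : X \<rightarrow> X\<guillemotright>"
    and comp_hom: "\<guillemotleft>f : X \<rightarrow> Y\<guillemotright> \<Longrightarrow> \<guillemotleft>g : Y \<rightarrow> Z\<guillemotright> \<Longrightarrow> \<guillemotleft>g \<cdot> f : X \<rightarrow> Z\<guillemotright>"
    and id_left: "\<guillemotleft>f : X \<rightarrow> Y\<guillemotright> \<Longrightarrow> \<one> Y \<cdot> f = f"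
    and id_right: "\<guillemotleft>f : X \<rightarrow> Y\<guillemotright> \<Longrightarrow> f \<cdot> \<one> X = f"
    and comp_assoc: "\<guillemotleft>f : W \<rightarrow> X\<guillemotright> \<Longrightarrow> \<guillemotleft>g : X \<rightarrow> Y\<guillemotright> \<Longrightarrow> \<guillemotleft>h : Y \<rightarrow> Z\<guillemotright> \<Longrightarrow>
      (h \<cdot> g) \<cdot> f = h \<cdot> (g \<cdot> f)"

context
  fixes C :: "('o, 'a, 'z) category_scheme" (structure)
begin

definition is_pullback :: "'a \<Rightarrow> 'a \<Rightarrow> 'o \<Rightarrow> 'a \<Rightarrow> 'a \<Rightarrow> bool" where
  "is_pullback f g P a b \<longleftrightarrow>
     f \<in> Ar C \<and> g \<in> Ar C \<and> Cod C f = Cod C g \<and>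
     \<guillemotleft>a : P \<rightarrow> Dom C f\<guillemotright> \<and> \<guillemotleft>b : P \<rightarrow> Dom C g\<guillemotright> \<and> f \<cdot> a = g \<cdot> b \<and>
     (\<forall>X x y. \<guillemotleft>x : X \<rightarrow> Dom C f\<guillemotright> \<and> \<guillemotleft>y : X \<rightarrow> Dom C g\<guillemotright> \<and> f \<cdot> x = g \<cdot> y \<longrightarrow>
        (\<exists>!u. \<guillemotleft>u : X \<rightarrow> P\<guillemotright> \<and> a \<cdot> u = x \<and> b \<cdot> u = y))"

definition is_product :: "'o \<Rightarrow> 'o \<Rightarrow> 'o \<Rightarrow> 'a \<Rightarrow> 'a \<Rightarrow> bool" where
  "is_product A B P a b \<longleftrightarrow>
     \<guillemotleft>a : P \<rightarrow> A\<guillemotright> \<and> \<guillemotleft>b : P \<rightarrow> B\<guillemotright> \<and>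
     (\<forall>X x y. \<guillemotleft>x : X \<rightarrow> A\<guillemotright> \<and> \<guillemotleft>y : X \<rightarrow> B\<guillemotright> \<longrightarrow>
        (\<exists>!u. \<guillemotleft>u : X \<rightarrow> P\<guillemotright> \<and> a \<cdot> u = x \<and> b \<cdot> u = y))"

definition is_equaliser :: "'a \<Rightarrow> 'a \<Rightarrow> 'o \<Rightarrow> 'a \<Rightarrow> bool" where
  "is_equaliser f g E h \<longleftrightarrow>
     f \<in> Ar C \<and> g \<in> Ar C \<and> Dom C f = Dom C g \<and> Cod C f = Cod C g \<and>
     \<guillemotleft>h : E \<rightarrow> Dom C f\<guillemotright> \<and> f \<cdot> h = g \<cdot> h \<and>
     (\<forall>X x. \<guillemotleft>x : X \<rightarrow> Dom C f\<guillemotright> \<and> f \<cdot> x = g \<cdot> x \<longrightarrow>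
        (\<exists>!u. \<guillemotleft>u : X \<rightarrow> E\<guillemotright> \<and> h \<cdot> u = x))"

text \<open>The \<open>n\<close>-th power of \<open>f\<close> in the slice category over its codomain, with structure arrow \<open>q\<close>
  (so that \<open>n = 0\<close> gives the terminal object of the slice).\<close>

definition is_fibre_power :: "'a \<Rightarrow> nat \<Rightarrow> 'o \<Rightarrow> 'a \<Rightarrow> (nat \<Rightarrow> 'a) \<Rightarrow> bool" where
  "is_fibre_power f n P q pr \<longleftrightarrow>
     f \<in> Ar C \<and> \<guillemotleft>q : P \<rightarrow> Cod C f\<guillemotright> \<and>
     (\<forall>i<n. \<guillemotleft>pr i : P \<rightarrow> Dom C f\<guillemotright> \<and> f \<cdot> pr i = q) \<and>
     (\<forall>X r x. \<guillemotleft>r : X \<rightarrow> Cod C f\<guillemotright> \<and> (\<forall>i<n. \<guillemotleft>x i : X \<rightarrow> Dom C f\<guillemotright> \<and> f \<cdot> x i = r) \<longrightarrow>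
        (\<exists>!u. \<guillemotleft>u : X \<rightarrow> P\<guillemotright> \<and> q \<cdot> u = r \<and> (\<forall>i<n. pr i \<cdot> u = x i)))"

text \<open>The arrow \<open>(x, y)\<close> into a product or pullback with projections \<open>a\<close> and \<open>b\<close>.\<close>

definition pair :: "'a \<Rightarrow> 'a \<Rightarrow> 'a \<Rightarrow> 'a \<Rightarrow> 'a" where
  "pair a b x y = (THE u. \<guillemotleft>u : Dom C x \<rightarrow> Dom C a\<guillemotright> \<and> a \<cdot> u = x \<and> b \<cdot> u = y)"

end

section \<open>Additive bundles\<close>

record ('o, 'a) bundle_data =
  Tot :: 'o
  Base :: 'o
  Prj :: 'a
  Zer :: 'a
  Sq :: 'o  \<comment> \<open>the fibre product of \<open>Prj\<close> with itself, with projections \<open>Fst\<close>, \<open>Snd\<close>\<close>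
  Fst :: 'a
  Snd :: 'a
  Sum :: 'a

context
  fixes C :: "('o, 'a, 'z) category_scheme" (structure)
begin

definition bplus :: "('o, 'a, 'y) bundle_data_scheme \<Rightarrow> 'a \<Rightarrow> 'a \<Rightarrow> 'a" where
  "bplus B x y = Sum B \<cdot> pair C (Fst B) (Snd B) x y"

text \<open>Generalised elements \<open>x\<close>, \<open>y\<close> of the total space, at the same stage and in the same fibre.\<close>

definition same_fibre :: "('o, 'a, 'y) bundle_data_scheme \<Rightarrow> 'a \<Rightarrow> 'a \<Rightarrow> bool" where
  "same_fibre B x y \<longleftrightarrow>
     \<guillemotleft>x : Dom C x \<rightarrow> Tot B\<guillemotright> \<and> \<guillemotleft>y : Dom C x \<rightarrow> Tot B\<guillemotright> \<and> Prj B \<cdot> x = Prj B \<cdot> y"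

definition additive_bundle :: "('o, 'a, 'y) bundle_data_scheme \<Rightarrow> bool" where
  "additive_bundle B \<longleftrightarrow>
     \<guillemotleft>Prj B : Tot B \<rightarrow> Base B\<guillemotright> \<and>
     \<guillemotleft>Zer B : Base B \<rightarrow> Tot B\<guillemotright> \<and> Prj B \<cdot> Zer B = \<one> (Base B) \<and>
     is_pullback C (Prj B) (Prj B) (Sq B) (Fst B) (Snd B) \<and>
     \<guillemotleft>Sum B : Sq B \<rightarrow> Tot B\<guillemotright> \<and> Prj B \<cdot> Sum B = Prj B \<cdot> Fst B \<and>
     (\<forall>x y z. same_fibre B x y \<and> same_fibre B y z \<longrightarrow>
        bplus B (bplus B x y) z = bplus B x (bplus B y z)) \<and>
     (\<forall>x y. same_fibre B x y \<longrightarrow> bplus B x y = bplus B y x) \<and>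
     (\<forall>X x. \<guillemotleft>x : X \<rightarrow> Tot B\<guillemotright> \<longrightarrow> bplus B (Zer B \<cdot> Prj B \<cdot> x) x = x)"

definition group_bundle :: "('o, 'a, 'y) bundle_data_scheme \<Rightarrow> bool" where
  "group_bundle B \<longleftrightarrow> additive_bundle B \<and>
     (\<exists>n. \<guillemotleft>n : Tot B \<rightarrow> Tot B\<guillemotright> \<and> Prj B \<cdot> n = Prj B \<and>
       (\<forall>X x. \<guillemotleft>x : X \<rightarrow> Tot B\<guillemotright> \<longrightarrow> bplus B (n \<cdot> x) x = Zer B \<cdot> Prj B \<cdot> x))"

definition additive_bundle_morphism ::
    "('o, 'a, 'y) bundle_data_scheme \<Rightarrow> ('o, 'a, 'x) bundle_data_scheme \<Rightarrow> 'a \<Rightarrow> 'a \<Rightarrow> bool" where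
  "additive_bundle_morphism B B' f g \<longleftrightarrow>
     additive_bundle B \<and> additive_bundle B' \<and>
     \<guillemotleft>f : Tot B \<rightarrow> Tot B'\<guillemotright> \<and> \<guillemotleft>g : Base B \<rightarrow> Base B'\<guillemotright> \<and>
     Prj B' \<cdot> f = g \<cdot> Prj B \<and> f \<cdot> Zer B = Zer B' \<cdot> g \<and>
     (\<forall>x y. same_fibre B x y \<longrightarrow> f \<cdot> bplus B x y = bplus B' (f \<cdot> x) (f \<cdot> y))"

end

section \<open>Tangent categories\<close>

text \<open>\<open>TO\<close> and \<open>TA\<close> are the object and arrow parts of the endofunctor \<open>T\<close>; \<open>tp\<close>, \<open>tz\<close>, \<open>tplus\<close>,
  \<open>tlift\<close>, \<open>tc\<close> are the components of \<open>p\<close>, \<open>0\<close>, \<open>+\<close>, \<open>l\<close>, \<open>c\<close>.\<close>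

record ('o, 'a) tangent = "('o, 'a) category" +
  TO :: "'o \<Rightarrow> 'o"
  TA :: "'a \<Rightarrow> 'a"
  tp :: "'o \<Rightarrow> 'a"
  tz :: "'o \<Rightarrow> 'a"
  T2 :: "'o \<Rightarrow> 'o"  \<comment> \<open>a chosen fibre product of \<open>tp\<close> with itself, with projections \<open>pr1\<close>, \<open>pr2\<close>\<close>
  pr1 :: "'o \<Rightarrow> 'a"
  pr2 :: "'o \<Rightarrow> 'a"
  tplus :: "'o \<Rightarrow> 'a"
  tlift :: "'o \<Rightarrow> 'a"
  tc :: "'o \<Rightarrow> 'a"


context
  fixes C :: "('o, 'a, 'z) tangent_scheme" (structure)
begin

text \<open>A limit preserved by \<open>T\<close>: all iterates \<open>T\<^sup>k\<close>, \<open>k \<ge> 0\<close>, of the limit cone are limit cones.\<close>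

definition T_pullback :: "'a \<Rightarrow> 'a \<Rightarrow> 'o \<Rightarrow> 'a \<Rightarrow> 'a \<Rightarrow> bool" where
  "T_pullback f g P a b \<longleftrightarrow>
     (\<forall>k. is_pullback C ((TA C ^^ k) f) ((TA C ^^ k) g) ((TO C ^^ k) P)
            ((TA C ^^ k) a) ((TA C ^^ k) b))"

definition T_product :: "'o \<Rightarrow> 'o \<Rightarrow> 'o \<Rightarrow> 'a \<Rightarrow> 'a \<Rightarrow> bool" where
  "T_product A B P a b \<longleftrightarrow>
     (\<forall>k. is_product C ((TO C ^^ k) A) ((TO C ^^ k) B) ((TO C ^^ k) P)
            ((TA C ^^ k) a) ((TA C ^^ k) b))"

definition T_equaliser :: "'a \<Rightarrow> 'a \<Rightarrow> 'o \<Rightarrow> 'a \<Rightarrow> bool" where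
  "T_equaliser f g E h \<longleftrightarrow>
     (\<forall>k. is_equaliser C ((TA C ^^ k) f) ((TA C ^^ k) g) ((TO C ^^ k) E) ((TA C ^^ k) h))"

definition T_fibre_power :: "'a \<Rightarrow> nat \<Rightarrow> 'o \<Rightarrow> 'a \<Rightarrow> (nat \<Rightarrow> 'a) \<Rightarrow> bool" where
  "T_fibre_power f n P q pr \<longleftrightarrow>
     (\<forall>k. is_fibre_power C ((TA C ^^ k) f) n ((TO C ^^ k) P)
            ((TA C ^^ k) q) (\<lambda>i. (TA C ^^ k) (pr i)))"

definition tangent_bundle :: "'o \<Rightarrow> ('o, 'a) bundle_data" where
  "tangent_bundle M = \<lparr>Tot = TO C M, Base = M, Prj = tp C M, Zer = tz C M,
     Sq = T2 C M, Fst = pr1 C M, Snd = pr2 C M, Sum = tplus C M\<rparr>"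

definition T_bundle :: "('o, 'a) bundle_data \<Rightarrow> ('o, 'a) bundle_data" where
  "T_bundle B = \<lparr>Tot = TO C (Tot B), Base = TO C (Base B), Prj = TA C (Prj B),
     Zer = TA C (Zer B), Sq = TO C (Sq B), Fst = TA C (Fst B), Snd = TA C (Snd B),
     Sum = TA C (Sum B)\<rparr>"

text \<open>\<open>\<mu>(a, b) = T(+)(0b, la)\<close>\<close>

definition mu :: "'o \<Rightarrow> 'a" where
  "mu M = TA C (tplus C M) \<cdot>
     pair C (TA C (pr1 C M)) (TA C (pr2 C M))
       (tz C (TO C M) \<cdot> pr2 C M) (tlift C M \<cdot> pr1 C M)"

end

locale tangent_category = category C
  for C :: "('o, 'a, 'z) tangent_scheme" (structure) +
  assumes T_ob: "X \<in> Ob C \<Longrightarrow> TO C X \<in> Ob C"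
    and T_hom: "\<guillemotleft>f : X \<rightarrow> Y\<guillemotright> \<Longrightarrow> \<guillemotleft>TA C f : TO C X \<rightarrow> TO C Y\<guillemotright>"
    and T_id: "X \<in> Ob C \<Longrightarrow> TA C (\<one> X) = \<one> (TO C X)"
    and T_comp: "\<guillemotleft>f : X \<rightarrow> Y\<guillemotright> \<Longrightarrow> \<guillemotleft>g : Y \<rightarrow> Z\<guillemotright> \<Longrightarrow> TA C (g \<cdot> f) = TA C g \<cdot> TA C f"
    and p_hom: "M \<in> Ob C \<Longrightarrow> \<guillemotleft>tp C M : TO C M \<rightarrow> M\<guillemotright>"
    and p_nat: "\<guillemotleft>f : M \<rightarrow> N\<guillemotright> \<Longrightarrow> tp C N \<cdot> TA C f = f \<cdot> tp C M"
    and zero_hom: "M \<in> Ob C \<Longrightarrow> \<guillemotleft>tz C M : M \<rightarrow> TO C M\<guillemotright>"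
    and zero_nat: "\<guillemotleft>f : M \<rightarrow> N\<guillemotright> \<Longrightarrow> tz C N \<cdot> f = TA C f \<cdot> tz C M"
    and powers: "M \<in> Ob C \<Longrightarrow> \<exists>P q pr. T_fibre_power C (tp C M) n P q pr"
    and T2_pullback: "M \<in> Ob C \<Longrightarrow>
      T_pullback C (tp C M) (tp C M) (T2 C M) (pr1 C M) (pr2 C M)"
    and plus_hom: "M \<in> Ob C \<Longrightarrow> \<guillemotleft>tplus C M : T2 C M \<rightarrow> TO C M\<guillemotright>"
    and plus_nat: "\<guillemotleft>f : M \<rightarrow> N\<guillemotright> \<Longrightarrow>
      tplus C N \<cdot> pair C (pr1 C N) (pr2 C N) (TA C f \<cdot> pr1 C M) (TA C f \<cdot> pr2 C M) =
      TA C f \<cdot> tplus C M"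
    and l_hom: "M \<in> Ob C \<Longrightarrow> \<guillemotleft>tlift C M : TO C M \<rightarrow> TO C (TO C M)\<guillemotright>"
    and l_nat: "\<guillemotleft>f : M \<rightarrow> N\<guillemotright> \<Longrightarrow>
      tlift C N \<cdot> TA C f = TA C (TA C f) \<cdot> tlift C M"
    and c_hom: "M \<in> Ob C \<Longrightarrow> \<guillemotleft>tc C M : TO C (TO C M) \<rightarrow> TO C (TO C M)\<guillemotright>"
    and c_nat: "\<guillemotleft>f : M \<rightarrow> N\<guillemotright> \<Longrightarrow> tc C N \<cdot> TA C (TA C f) = TA C (TA C f) \<cdot> tc C M"
    and tangent_additive: "M \<in> Ob C \<Longrightarrow> additive_bundle C (tangent_bundle C M)"
    and l_additive: "M \<in> Ob C \<Longrightarrow>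
      additive_bundle_morphism C (tangent_bundle C M) (T_bundle C (tangent_bundle C M))
        (tlift C M) (tz C M)"
    and c_additive: "M \<in> Ob C \<Longrightarrow>
      additive_bundle_morphism C (T_bundle C (tangent_bundle C M)) (tangent_bundle C (TO C M))
        (tc C M) (\<one> (TO C M))"
    and c_c: "M \<in> Ob C \<Longrightarrow> tc C M \<cdot> tc C M = \<one> (TO C (TO C M))"
    and c_braid: "M \<in> Ob C \<Longrightarrow>
      TA C (tc C M) \<cdot> tc C (TO C M) \<cdot> TA C (tc C M) =
      tc C (TO C M) \<cdot> TA C (tc C M) \<cdot> tc C (TO C M)"
    and c_l: "M \<in> Ob C \<Longrightarrow> tc C M \<cdot> tlift C M = tlift C M"
    and l_l: "M \<in> Ob C \<Longrightarrow>
      TA C (tlift C M) \<cdot> tlift C M = tlift C (TO C M) \<cdot> tlift C M"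
    and c_c_l: "M \<in> Ob C \<Longrightarrow>
      tc C (TO C M) \<cdot> TA C (tc C M) \<cdot> tlift C (TO C M) = TA C (tlift C M) \<cdot> tc C M"
    and mu_equaliser: "M \<in> Ob C \<Longrightarrow>
      T_equaliser C (TA C (tp C M)) (tz C M \<cdot> tp C M \<cdot> tp C (TO C M)) (T2 C M) (mu C M)"

locale tangent_category_with_negatives = tangent_category +
  assumes negatives: "M \<in> Ob C \<Longrightarrow> group_bundle C (tangent_bundle C M)"

section \<open>Groupoids in a category\<close>

record ('o, 'a) groupoid =
  Arrs :: 'o
  Objs :: 'o
  src :: 'a
  tgt :: 'a
  unt :: 'a
  ginv :: 'a
  Cps :: 'o  \<comment> \<open>composable pairs \<open>(g, h)\<close> with \<open>src g = tgt h\<close>, with projections \<open>cfst\<close>, \<open>csnd\<close>\<close>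
  cfst :: 'a
  csnd :: 'a
  cmp :: 'a

definition gcomp :: "('o, 'a, 'z) category_scheme \<Rightarrow> ('o, 'a) groupoid \<Rightarrow> 'a \<Rightarrow> 'a \<Rightarrow> 'a" where
  "gcomp C \<G> g h = cmp \<G> \<cdot>\<^bsub>C\<^esub> pair C (cfst \<G>) (csnd \<G>) g h"

locale internal_groupoid = category C
  for C :: "('o, 'a, 'z) category_scheme" (structure) +
  fixes \<G> :: "('o, 'a) groupoid"
  assumes src_hom: "\<guillemotleft>src \<G> : Arrs \<G> \<rightarrow> Objs \<G>\<guillemotright>"
    and tgt_hom: "\<guillemotleft>tgt \<G> : Arrs \<G> \<rightarrow> Objs \<G>\<guillemotright>"
    and unt_hom: "\<guillemotleft>unt \<G> : Objs \<G> \<rightarrow> Arrs \<G>\<guillemotright>"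
    and ginv_hom: "\<guillemotleft>ginv \<G> : Arrs \<G> \<rightarrow> Arrs \<G>\<guillemotright>"
    and Cps_pullback: "is_pullback C (src \<G>) (tgt \<G>) (Cps \<G>) (cfst \<G>) (csnd \<G>)"
    and cmp_hom: "\<guillemotleft>cmp \<G> : Cps \<G> \<rightarrow> Arrs \<G>\<guillemotright>"
    and src_unt: "src \<G> \<cdot> unt \<G> = \<one> (Objs \<G>)"
    and tgt_unt: "tgt \<G> \<cdot> unt \<G> = \<one> (Objs \<G>)"
    and src_cmp: "src \<G> \<cdot> cmp \<G> = src \<G> \<cdot> csnd \<G>"
    and tgt_cmp: "tgt \<G> \<cdot> cmp \<G> = tgt \<G> \<cdot> cfst \<G>"
    and src_ginv: "src \<G> \<cdot> ginv \<G> = tgt \<G>"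
    and tgt_ginv: "tgt \<G> \<cdot> ginv \<G> = src \<G>"
    and gcomp_assoc: "\<guillemotleft>f : X \<rightarrow> Arrs \<G>\<guillemotright> \<Longrightarrow> \<guillemotleft>g : X \<rightarrow> Arrs \<G>\<guillemotright> \<Longrightarrow> \<guillemotleft>h : X \<rightarrow> Arrs \<G>\<guillemotright> \<Longrightarrow>
      src \<G> \<cdot> f = tgt \<G> \<cdot> g \<Longrightarrow> src \<G> \<cdot> g = tgt \<G> \<cdot> h \<Longrightarrow>
      gcomp C \<G> (gcomp C \<G> f g) h = gcomp C \<G> f (gcomp C \<G> g h)"
    and gcomp_unt_left: "\<guillemotleft>g : X \<rightarrow> Arrs \<G>\<guillemotright> \<Longrightarrow> gcomp C \<G> (unt \<G> \<cdot> tgt \<G> \<cdot> g) g = g"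
    and gcomp_unt_right: "\<guillemotleft>g : X \<rightarrow> Arrs \<G>\<guillemotright> \<Longrightarrow> gcomp C \<G> g (unt \<G> \<cdot> src \<G> \<cdot> g) = g"
    and gcomp_ginv_left: "\<guillemotleft>g : X \<rightarrow> Arrs \<G>\<guillemotright> \<Longrightarrow>
      gcomp C \<G> (ginv \<G> \<cdot> g) g = unt \<G> \<cdot> src \<G> \<cdot> g"
    and gcomp_ginv_right: "\<guillemotleft>g : X \<rightarrow> Arrs \<G>\<guillemotright> \<Longrightarrow>
      gcomp C \<G> g (ginv \<G> \<cdot> g) = unt \<G> \<cdot> tgt \<G> \<cdot> g"

text \<open>The objects of composable pairs and of composable triples exist and are preserved by \<open>T\<close>.\<close>

locale tangent_groupoid = tangent_category_with_negatives C + internal_groupoid C \<G>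
  for C :: "('o, 'a, 'z) tangent_scheme" (structure) and \<G> :: "('o, 'a) groupoid" +
  assumes T_pairs: "T_pullback C (src \<G>) (tgt \<G>) (Cps \<G>) (cfst \<G>) (csnd \<G>)"
    and T_triples: "\<exists>P a b. T_pullback C (src \<G> \<cdot> csnd \<G>) (tgt \<G>) P a b"

definition T_groupoid :: "('o, 'a, 'z) tangent_scheme \<Rightarrow> ('o, 'a) groupoid \<Rightarrow> ('o, 'a) groupoid" where
  "T_groupoid C \<G> = \<lparr>Arrs = TO C (Arrs \<G>), Objs = TO C (Objs \<G>),
     src = TA C (src \<G>), tgt = TA C (tgt \<G>), unt = TA C (unt \<G>), ginv = TA C (ginv \<G>),
     Cps = TO C (Cps \<G>), cfst = TA C (cfst \<G>), csnd = TA C (csnd \<G>), cmp = TA C (cmp \<G>)\<rparr>"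

section \<open>The associated anchored bundle and the map \<open>\<alpha>\<close>\<close>

record ('o, 'a) anchored_bundle = "('o, 'a) bundle_data" +
  Lft :: 'a
  Anc :: 'a

text \<open>\<open>E\<close> is the pullback of \<open>(p, T(s)) : T(G) \<rightarrow> G \<times> T(M)\<close> along \<open>(e, 0) : M \<rightarrow> G \<times> T(M)\<close>, where
  \<open>Q\<close> is the product \<open>G \<times> T(M)\<close> with projections \<open>q1\<close>, \<open>q2\<close>. Zero section, addition and lift are
  inherited from the tangent bundle of \<open>G\<close> along the inclusion \<open>\<iota>\<close>.\<close>

locale associated_anchored_bundle = tangent_groupoid C \<G>
  for C :: "('o, 'a, 'z) tangent_scheme" (structure) and \<G> :: "('o, 'a) groupoid" +
  fixes E :: "('o, 'a) anchored_bundle" and \<iota> :: 'a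
    and Q :: 'o and q1 :: 'a and q2 :: 'a
  assumes Q_product: "T_product C (Arrs \<G>) (TO C (Objs \<G>)) Q q1 q2"
    and E_pullback: "T_pullback C
      (pair C q1 q2 (tp C (Arrs \<G>)) (TA C (src \<G>)))
      (pair C q1 q2 (unt \<G>) (tz C (Objs \<G>)))
      (Tot E) \<iota> (Prj E)"
    and E_base: "Base E = Objs \<G>"
    and E_zero_hom: "\<guillemotleft>Zer E : Base E \<rightarrow> Tot E\<guillemotright>"
    and E_zero: "\<iota> \<cdot> Zer E = tz C (Arrs \<G>) \<cdot> unt \<G>"
    and E_square: "T_pullback C (Prj E) (Prj E) (Sq E) (Fst E) (Snd E)"
    and E_plus_hom: "\<guillemotleft>Sum E : Sq E \<rightarrow> Tot E\<guillemotright>"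
    and E_plus: "\<iota> \<cdot> Sum E =
      bplus C (tangent_bundle C (Arrs \<G>)) (\<iota> \<cdot> Fst E) (\<iota> \<cdot> Snd E)"
    and E_lift_hom: "\<guillemotleft>Lft E : Tot E \<rightarrow> TO C (Tot E)\<guillemotright>"
    and E_lift: "TA C \<iota> \<cdot> Lft E = tlift C (Arrs \<G>) \<cdot> \<iota>"
    and E_anchor: "Anc E = TA C (tgt \<G>) \<cdot> \<iota>"

text \<open>\<open>cw \<circ> 0v \<circ> (c0pw)\<inverse>\<close> for generalised elements \<open>v\<close> of \<open>T(G)\<close> and \<open>w\<close> of \<open>T\<^sup>2(G)\<close>.\<close>

definition alpha :: "('o, 'a, 'z) tangent_scheme \<Rightarrow> ('o, 'a) groupoid \<Rightarrow> 'a \<Rightarrow> 'a \<Rightarrow> 'a" where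
  "alpha C \<G> v w =
    (let G = Arrs \<G>; TG = TO C G; T2\<G> = T_groupoid C (T_groupoid C \<G>) in
     gcomp C T2\<G>
       (gcomp C T2\<G> (tc C G \<cdot>\<^bsub>C\<^esub> w) (tz C TG \<cdot>\<^bsub>C\<^esub> v))
       (ginv T2\<G> \<cdot>\<^bsub>C\<^esub> tc C G \<cdot>\<^bsub>C\<^esub> tz C TG \<cdot>\<^bsub>C\<^esub> tp C TG \<cdot>\<^bsub>C\<^esub> w))"

end

theory Submission
  imports Defs
begin

text \<open>An element \<open>u\<close> of \<open>T\<^sup>2(G)\<close> lies in \<open>T(A)\<close> as soon as \<open>T(p) u = T(e) y\<close> and
  \<open>T\<^sup>2(s) u = T(0) y\<close> for some \<open>y\<close> in \<open>T(M)\<close>, because \<open>T\<close> preserves the pullback that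
  defines \<open>A\<close> (\<open>factor_through_T_anchored\<close>). For \<open>u = \<alpha>(v, w)\<close> these hold with \<open>y = T(t) p w\<close>
  (\<open>alpha_values\<close>).

  The source of \<open>\<alpha>(v, w)\<close> is that of its last factor, namely the target
  \<open>T\<^sup>2(t) c 0 p w = c 0 T(t) p w = T(0) y\<close> of \<open>c 0 p w\<close>. For the other equation, \<open>T(p)\<close> is a
  functor from \<open>T\<^sup>2(G)\<close> to \<open>T(G)\<close> by naturality of \<open>p\<close> (\<open>T_p_gcomp\<close>). It sends \<open>c w\<close> to
  \<open>p w\<close>, sends \<open>0 v\<close> to \<open>0 p v = 0 e m = T(e) 0 m\<close>, an identity arrow, and sends \<open>c 0 p w\<close> to
  \<open>p 0 p w = p w\<close>. Hence \<open>T(p) \<alpha>(v, w) = p w \<circ> (p w)\<inverse> = T(e) T(t) p w\<close>.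

  The calculation uses the groupoid laws in \<open>T(G)\<close> and \<open>T\<^sup>2(G)\<close>, which hold because \<open>T\<close>
  preserves the objects of composable pairs and triples
  (\<open>tangent_groupoid_T_groupoid\<close>).\<close>

section \<open>Composition and limits\<close>

context category
begin

lemma hom_ob: "\<guillemotleft>f : X \<rightarrow> Y\<guillemotright> \<Longrightarrow> X \<in> Ob C" "\<guillemotleft>f : X \<rightarrow> Y\<guillemotright> \<Longrightarrow> Y \<in> Ob C"
  using dom_in cod_in by (auto simp: in_hom_def)

text \<open>An equation between composites may be applied to a generalised element.\<close>

lemma whisker:
  assumes "g \<cdot> f = k \<cdot> h" "\<guillemotleft>f : X \<rightarrow> Y\<guillemotright>" "\<guillemotleft>g : Y \<rightarrow> Z\<guillemotright>" "\<guillemotleft>h : X \<rightarrow> Y'\<guillemotright>" "\<guillemotleft>k : Y' \<rightarrow> Z\<guillemotright>"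
    "\<guillemotleft>x : W \<rightarrow> X\<guillemotright>"
  shows "g \<cdot> f \<cdot> x = k \<cdot> h \<cdot> x"
  using comp_assoc[OF assms(6,2,3)] comp_assoc[OF assms(6,4,5)] assms(1) by simp

lemma whisker1:
  assumes "g \<cdot> f = h" "\<guillemotleft>f : X \<rightarrow> Y\<guillemotright>" "\<guillemotleft>g : Y \<rightarrow> Z\<guillemotright>" "\<guillemotleft>x : W \<rightarrow> X\<guillemotright>"
  shows "g \<cdot> f \<cdot> x = h \<cdot> x"
  using comp_assoc[OF assms(4,2,3)] assms(1) by simp

lemma whisker_id:
  assumes "g \<cdot> f = \<one> X" "\<guillemotleft>f : X \<rightarrow> Y\<guillemotright>" "\<guillemotleft>g : Y \<rightarrow> X\<guillemotright>" "\<guillemotleft>x : W \<rightarrow> X\<guillemotright>"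
  shows "g \<cdot> f \<cdot> x = x"
  using whisker1[OF assms] id_left[OF assms(4)] by simp

lemma is_pullbackD:
  assumes "is_pullback C f g P a b"
  shows "\<guillemotleft>f : Dom C f \<rightarrow> Cod C f\<guillemotright>" "\<guillemotleft>g : Dom C g \<rightarrow> Cod C f\<guillemotright>"
    "\<guillemotleft>a : P \<rightarrow> Dom C f\<guillemotright>" "\<guillemotleft>b : P \<rightarrow> Dom C g\<guillemotright>" "f \<cdot> a = g \<cdot> b"
  using assms by (auto simp: is_pullback_def in_hom_def)

lemma pullback_factor:
  assumes "is_pullback C f g P a b"
    and "\<guillemotleft>x : X \<rightarrow> Dom C f\<guillemotright>" "\<guillemotleft>y : X \<rightarrow> Dom C g\<guillemotright>" "f \<cdot> x = g \<cdot> y"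
  shows "\<exists>!u. \<guillemotleft>u : X \<rightarrow> P\<guillemotright> \<and> a \<cdot> u = x \<and> b \<cdot> u = y"
  using assms unfolding is_pullback_def by blast

lemma pullback_pair:
  assumes pb: "is_pullback C f g P a b"
    and x: "\<guillemotleft>x : X \<rightarrow> Dom C f\<guillemotright>" and y: "\<guillemotleft>y : X \<rightarrow> Dom C g\<guillemotright>" and eq: "f \<cdot> x = g \<cdot> y"
  shows "\<guillemotleft>pair C a b x y : X \<rightarrow> P\<guillemotright>" "a \<cdot> pair C a b x y = x" "b \<cdot> pair C a b x y = y"
proof -
  have "Dom C x = X" "Dom C a = P" using x is_pullbackD(3)[OF pb] by (auto simp: in_hom_def)
  then have "\<guillemotleft>pair C a b x y : X \<rightarrow> P\<guillemotright> \<and> a \<cdot> pair C a b x y = x \<and> b \<cdot> pair C a b x y = y"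
    unfolding pair_def using theI'[OF pullback_factor[OF pb x y eq]] by simp
  then show "\<guillemotleft>pair C a b x y : X \<rightarrow> P\<guillemotright>" "a \<cdot> pair C a b x y = x" "b \<cdot> pair C a b x y = y"
    by auto
qed

lemma pullback_pair_eqI:
  assumes pb: "is_pullback C f g P a b" and u: "\<guillemotleft>u : X \<rightarrow> P\<guillemotright>" "a \<cdot> u = x" "b \<cdot> u = y"
  shows "pair C a b x y = u"
proof -
  note h = is_pullbackD[OF pb]
  have x: "\<guillemotleft>x : X \<rightarrow> Dom C f\<guillemotright>" and y: "\<guillemotleft>y : X \<rightarrow> Dom C g\<guillemotright>"
    using comp_hom u h by blast+
  have eq: "f \<cdot> x = g \<cdot> y"
    using whisker[OF h(5,3,1,4,2) u(1)] u by simp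
  show ?thesis
    using pullback_factor[OF pb x y eq] pullback_pair[OF pb x y eq] u by blast
qed

lemma product_pair:
  assumes pr: "is_product C A B P a b" and x: "\<guillemotleft>x : X \<rightarrow> A\<guillemotright>" and y: "\<guillemotleft>y : X \<rightarrow> B\<guillemotright>"
  shows "\<guillemotleft>pair C a b x y : X \<rightarrow> P\<guillemotright>" "a \<cdot> pair C a b x y = x" "b \<cdot> pair C a b x y = y"
proof -
  have ex: "\<exists>!u. \<guillemotleft>u : X \<rightarrow> P\<guillemotright> \<and> a \<cdot> u = x \<and> b \<cdot> u = y"
    using pr x y unfolding is_product_def by blast
  have "Dom C x = X" "Dom C a = P" using x pr by (auto simp: in_hom_def is_product_def)
  then have "\<guillemotleft>pair C a b x y : X \<rightarrow> P\<guillemotright> \<and> a \<cdot> pair C a b x y = x \<and> b \<cdot> pair C a b x y = y"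
    unfolding pair_def using theI'[OF ex] by simp
  then show "\<guillemotleft>pair C a b x y : X \<rightarrow> P\<guillemotright>" "a \<cdot> pair C a b x y = x" "b \<cdot> pair C a b x y = y"
    by auto
qed

lemma product_joint_mono:
  assumes pr: "is_product C A B P a b" and "\<guillemotleft>u : X \<rightarrow> P\<guillemotright>" "\<guillemotleft>u' : X \<rightarrow> P\<guillemotright>"
    and "a \<cdot> u = a \<cdot> u'" "b \<cdot> u = b \<cdot> u'"
  shows "u = u'"
proof -
  have "\<guillemotleft>a \<cdot> u : X \<rightarrow> A\<guillemotright>" "\<guillemotleft>b \<cdot> u : X \<rightarrow> B\<guillemotright>"
    using assms comp_hom unfolding is_product_def by blast+
  then have "\<exists>!k. \<guillemotleft>k : X \<rightarrow> P\<guillemotright> \<and> a \<cdot> k = a \<cdot> u \<and> b \<cdot> k = b \<cdot> u"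
    using pr unfolding is_product_def by blast
  then show ?thesis using assms by metis
qed

section \<open>Composition of generalised elements of a groupoid\<close>

lemma gcomp_element:
  assumes pb: "is_pullback C (src \<G>) (tgt \<G>) (Cps \<G>) (cfst \<G>) (csnd \<G>)"
    and cm: "\<guillemotleft>cmp \<G> : Cps \<G> \<rightarrow> Arrs \<G>\<guillemotright>"
    and g: "\<guillemotleft>g : X \<rightarrow> Dom C (src \<G>)\<guillemotright>" and h: "\<guillemotleft>h : X \<rightarrow> Dom C (tgt \<G>)\<guillemotright>"
    and eq: "src \<G> \<cdot> g = tgt \<G> \<cdot> h" and x: "\<guillemotleft>x : Y \<rightarrow> X\<guillemotright>"
  shows "gcomp C \<G> g h \<cdot> x = gcomp C \<G> (g \<cdot> x) (h \<cdot> x)"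
proof -
  note P = pullback_pair[OF pb g h eq] and D = is_pullbackD[OF pb]
  have "pair C (cfst \<G>) (csnd \<G>) (g \<cdot> x) (h \<cdot> x) = pair C (cfst \<G>) (csnd \<G>) g h \<cdot> x"
    by (rule pullback_pair_eqI[OF pb comp_hom[OF x P(1)]])
      (use whisker1[OF P(2,1) D(3) x] whisker1[OF P(3,1) D(4) x] in simp_all)
  then show ?thesis
    unfolding gcomp_def using comp_assoc[OF x P(1) cm] by simp
qed

end

context internal_groupoid
begin

lemma dom_src_tgt: "Dom C (src \<G>) = Arrs \<G>" "Dom C (tgt \<G>) = Arrs \<G>"
  using src_hom tgt_hom by (auto simp: in_hom_def)

lemma cfst_hom: "\<guillemotleft>cfst \<G> : Cps \<G> \<rightarrow> Arrs \<G>\<guillemotright>" and csnd_hom: "\<guillemotleft>csnd \<G> : Cps \<G> \<rightarrow> Arrs \<G>\<guillemotright>"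
  using is_pullbackD[OF Cps_pullback] dom_src_tgt by auto

lemma gpair:
  assumes "\<guillemotleft>g : X \<rightarrow> Arrs \<G>\<guillemotright>" "\<guillemotleft>h : X \<rightarrow> Arrs \<G>\<guillemotright>" "src \<G> \<cdot> g = tgt \<G> \<cdot> h"
  shows "\<guillemotleft>pair C (cfst \<G>) (csnd \<G>) g h : X \<rightarrow> Cps \<G>\<guillemotright>"
    "cfst \<G> \<cdot> pair C (cfst \<G>) (csnd \<G>) g h = g"
    "csnd \<G> \<cdot> pair C (cfst \<G>) (csnd \<G>) g h = h"
  using pullback_pair[OF Cps_pullback] assms dom_src_tgt by metis+

lemma gcomp_hom:
  assumes "\<guillemotleft>g : X \<rightarrow> Arrs \<G>\<guillemotright>" "\<guillemotleft>h : X \<rightarrow> Arrs \<G>\<guillemotright>" "src \<G> \<cdot> g = tgt \<G> \<cdot> h"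
  shows "\<guillemotleft>gcomp C \<G> g h : X \<rightarrow> Arrs \<G>\<guillemotright>"
  unfolding gcomp_def by (rule comp_hom[OF gpair(1)[OF assms] cmp_hom])

lemma src_gcomp:
  assumes "\<guillemotleft>g : X \<rightarrow> Arrs \<G>\<guillemotright>" "\<guillemotleft>h : X \<rightarrow> Arrs \<G>\<guillemotright>" "src \<G> \<cdot> g = tgt \<G> \<cdot> h"
  shows "src \<G> \<cdot> gcomp C \<G> g h = src \<G> \<cdot> h"
  unfolding gcomp_def
  using whisker[OF src_cmp cmp_hom src_hom csnd_hom src_hom gpair(1)[OF assms]]
    gpair(3)[OF assms] by simp

text \<open>An internal functor, given by \<open>F\<close> on arrows and \<open>F2\<close> on composable pairs, preserves the
  composition of generalised elements.\<close>

lemma functor_gcomp: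
  assumes K: "internal_groupoid C K"
    and F: "\<guillemotleft>F : Arrs \<G> \<rightarrow> Arrs K\<guillemotright>" and F2: "\<guillemotleft>F2 : Cps \<G> \<rightarrow> Cps K\<guillemotright>"
    and fst: "cfst K \<cdot> F2 = F \<cdot> cfst \<G>" and snd: "csnd K \<cdot> F2 = F \<cdot> csnd \<G>"
    and cmp: "cmp K \<cdot> F2 = F \<cdot> cmp \<G>"
    and g: "\<guillemotleft>g : X \<rightarrow> Arrs \<G>\<guillemotright>" and h: "\<guillemotleft>h : X \<rightarrow> Arrs \<G>\<guillemotright>"
    and eq: "src \<G> \<cdot> g = tgt \<G> \<cdot> h"
  shows "F \<cdot> gcomp C \<G> g h = gcomp C K (F \<cdot> g) (F \<cdot> h)"
proof -
  interpret K: internal_groupoid C K by (rule K)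
  note P = gpair[OF g h eq]
  have "pair C (cfst K) (csnd K) (F \<cdot> g) (F \<cdot> h) = F2 \<cdot> pair C (cfst \<G>) (csnd \<G>) g h"
    by (rule pullback_pair_eqI[OF K.Cps_pullback comp_hom[OF P(1) F2]])
      (use whisker[OF fst F2 K.cfst_hom cfst_hom F P(1)]
        whisker[OF snd F2 K.csnd_hom csnd_hom F P(1)] P in simp_all)
  then show ?thesis
    unfolding gcomp_def using whisker[OF cmp F2 K.cmp_hom cmp_hom F P(1)] by simp
qed

end

section \<open>The tangent groupoid\<close>

lemma T_pullback_shift:
  "T_pullback C f g P a b \<Longrightarrow> T_pullback C (TA C f) (TA C g) (TO C P) (TA C a) (TA C b)"
  unfolding T_pullback_def by (metis funpow_Suc_right o_apply)

lemma T_pullback_level: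
  assumes "T_pullback C f g P a b"
  shows "is_pullback C f g P a b"
    and "is_pullback C (TA C f) (TA C g) (TO C P) (TA C a) (TA C b)"
  using assms[unfolded T_pullback_def, rule_format, of 0]
    assms[unfolded T_pullback_def, rule_format, of 1] by simp_all

context tangent_groupoid
begin

lemma T_Cps_pullback:
  "is_pullback C (TA C (src \<G>)) (TA C (tgt \<G>)) (TO C (Cps \<G>)) (TA C (cfst \<G>)) (TA C (csnd \<G>))"
  by (rule T_pullback_level(2)[OF T_pairs])

lemma T_gcomp:
  assumes "\<guillemotleft>g : X \<rightarrow> Arrs \<G>\<guillemotright>" "\<guillemotleft>h : X \<rightarrow> Arrs \<G>\<guillemotright>" "src \<G> \<cdot> g = tgt \<G> \<cdot> h"
  shows "TA C (gcomp C \<G> g h) = gcomp C (T_groupoid C \<G>) (TA C g) (TA C h)"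
proof -
  note P = gpair[OF assms]
  have "pair C (TA C (cfst \<G>)) (TA C (csnd \<G>)) (TA C g) (TA C h) =
      TA C (pair C (cfst \<G>) (csnd \<G>) g h)"
    by (rule pullback_pair_eqI[OF T_Cps_pullback T_hom[OF P(1)]])
      (use T_comp[OF P(1) cfst_hom] T_comp[OF P(1) csnd_hom] P in simp_all)
  then show ?thesis
    unfolding gcomp_def T_groupoid_def using T_comp[OF P(1) cmp_hom] by simp
qed

text \<open>Composing generalised elements of \<open>T(G)\<close> that factor through the image under \<open>T\<close> of a
  composable pair in \<open>G\<close>. An equational law of \<open>G\<close> holds at the universal tuple of
  composable arrows; since \<open>T\<close> preserves the object of such tuples, the law carries over to \<open>T(G)\<close>.\<close>

lemma T_gcomp_element:
  assumes g: "\<guillemotleft>g : X \<rightarrow> Arrs \<G>\<guillemotright>" and h: "\<guillemotleft>h : X \<rightarrow> Arrs \<G>\<guillemotright>"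
    and eq: "src \<G> \<cdot> g = tgt \<G> \<cdot> h" and x: "\<guillemotleft>x : Y \<rightarrow> TO C X\<guillemotright>"
  shows "gcomp C (T_groupoid C \<G>) (TA C g \<cdot> x) (TA C h \<cdot> x) = TA C (gcomp C \<G> g h) \<cdot> x"
proof -
  have "gcomp C (T_groupoid C \<G>) (TA C g) (TA C h) \<cdot> x =
      gcomp C (T_groupoid C \<G>) (TA C g \<cdot> x) (TA C h \<cdot> x)"
  proof (rule gcomp_element[OF _ _ _ _ _ x])
    show "is_pullback C (src (T_groupoid C \<G>)) (tgt (T_groupoid C \<G>)) (Cps (T_groupoid C \<G>))
        (cfst (T_groupoid C \<G>)) (csnd (T_groupoid C \<G>))"
      using T_Cps_pullback by (simp add: T_groupoid_def)
    show "\<guillemotleft>cmp (T_groupoid C \<G>) : Cps (T_groupoid C \<G>) \<rightarrow> Arrs (T_groupoid C \<G>)\<guillemotright>"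
      using T_hom[OF cmp_hom] by (simp add: T_groupoid_def)
    show "\<guillemotleft>TA C g : TO C X \<rightarrow> Dom C (src (T_groupoid C \<G>))\<guillemotright>"
      "\<guillemotleft>TA C h : TO C X \<rightarrow> Dom C (tgt (T_groupoid C \<G>))\<guillemotright>"
      using T_hom[OF g] T_hom[OF h] T_hom[OF src_hom] T_hom[OF tgt_hom]
      by (simp_all add: T_groupoid_def in_hom_def)
    show "src (T_groupoid C \<G>) \<cdot> TA C g = tgt (T_groupoid C \<G>) \<cdot> TA C h"
      using T_comp[OF g src_hom] T_comp[OF h tgt_hom] eq by (simp add: T_groupoid_def)
  qed
  then show ?thesis using T_gcomp[OF g h eq] by simp
qed

lemma T_gcomp_assoc:
  assumes f: "\<guillemotleft>f : X \<rightarrow> TO C (Arrs \<G>)\<guillemotright>" and g: "\<guillemotleft>g : X \<rightarrow> TO C (Arrs \<G>)\<guillemotright>"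
    and h: "\<guillemotleft>h : X \<rightarrow> TO C (Arrs \<G>)\<guillemotright>"
    and fg: "TA C (src \<G>) \<cdot> f = TA C (tgt \<G>) \<cdot> g"
    and gh: "TA C (src \<G>) \<cdot> g = TA C (tgt \<G>) \<cdot> h"
  defines "\<H> \<equiv> T_groupoid C \<G>"
  shows "gcomp C \<H> (gcomp C \<H> f g) h = gcomp C \<H> f (gcomp C \<H> g h)"
proof -
  from T_triples obtain P a b where tr: "T_pullback C (src \<G> \<cdot> csnd \<G>) (tgt \<G>) P a b" by blast
  note tr1 = T_pullback_level(1)[OF tr] and tr2 = T_pullback_level(2)[OF tr]
  have dom: "Dom C (src \<G> \<cdot> csnd \<G>) = Cps \<G>" "Dom C (TA C (src \<G> \<cdot> csnd \<G>)) = TO C (Cps \<G>)"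
    using comp_hom[OF csnd_hom src_hom] T_hom[OF comp_hom[OF csnd_hom src_hom]]
    by (simp_all add: in_hom_def)
  have a: "\<guillemotleft>a : P \<rightarrow> Cps \<G>\<guillemotright>" and b: "\<guillemotleft>b : P \<rightarrow> Arrs \<G>\<guillemotright>"
    using is_pullbackD[OF tr1] dom dom_src_tgt by auto
  have Tdom: "Dom C (TA C (src \<G>)) = TO C (Arrs \<G>)" "Dom C (TA C (tgt \<G>)) = TO C (Arrs \<G>)"
    using T_hom[OF src_hom] T_hom[OF tgt_hom] by (simp_all add: in_hom_def)
  \<comment> \<open>the universal composable triple\<close>
  define f0 g0 where "f0 = cfst \<G> \<cdot> a" and "g0 = csnd \<G> \<cdot> a"
  have f0: "\<guillemotleft>f0 : P \<rightarrow> Arrs \<G>\<guillemotright>" and g0: "\<guillemotleft>g0 : P \<rightarrow> Arrs \<G>\<guillemotright>"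
    unfolding f0_def g0_def using comp_hom[OF a] cfst_hom csnd_hom by auto
  have e1: "src \<G> \<cdot> f0 = tgt \<G> \<cdot> g0"
    unfolding f0_def g0_def
    by (rule whisker[OF is_pullbackD(5)[OF Cps_pullback] cfst_hom src_hom csnd_hom tgt_hom a])
  have e2: "src \<G> \<cdot> g0 = tgt \<G> \<cdot> b"
    unfolding g0_def using is_pullbackD(5)[OF tr1] comp_assoc[OF a csnd_hom src_hom] by simp
  define k where "k = pair C (TA C (cfst \<G>)) (TA C (csnd \<G>)) f g"
  have k: "\<guillemotleft>k : X \<rightarrow> TO C (Cps \<G>)\<guillemotright>" "TA C (cfst \<G>) \<cdot> k = f" "TA C (csnd \<G>) \<cdot> k = g"
    using pullback_pair[OF T_Cps_pullback, of f X g] f g fg Tdom by (simp_all add: k_def)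
  have "TA C (src \<G> \<cdot> csnd \<G>) \<cdot> k = TA C (tgt \<G>) \<cdot> h"
    using T_comp[OF csnd_hom src_hom] comp_assoc[OF k(1) T_hom[OF csnd_hom] T_hom[OF src_hom]]
      k(3) gh by simp
  then obtain u where u: "\<guillemotleft>u : X \<rightarrow> TO C P\<guillemotright>" "TA C a \<cdot> u = k" "TA C b \<cdot> u = h"
    using pullback_factor[OF tr2, of k X h] k(1) h dom Tdom by auto
  have fu: "TA C f0 \<cdot> u = f" and gu: "TA C g0 \<cdot> u = g"
    using comp_assoc[OF u(1) T_hom[OF a] T_hom[OF cfst_hom]] T_comp[OF a cfst_hom]
      comp_assoc[OF u(1) T_hom[OF a] T_hom[OF csnd_hom]] T_comp[OF a csnd_hom] u(2) k
    by (simp_all add: f0_def g0_def)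
  have c1: "\<guillemotleft>gcomp C \<G> f0 g0 : P \<rightarrow> Arrs \<G>\<guillemotright>" "src \<G> \<cdot> gcomp C \<G> f0 g0 = tgt \<G> \<cdot> b"
    using gcomp_hom[OF f0 g0 e1] src_gcomp[OF f0 g0 e1] e2 by auto
  have "tgt \<G> \<cdot> gcomp C \<G> g0 b = tgt \<G> \<cdot> g0"
    unfolding gcomp_def
    using whisker[OF tgt_cmp cmp_hom tgt_hom cfst_hom tgt_hom gpair(1)[OF g0 b e2]]
      gpair(2)[OF g0 b e2] by simp
  then have c2: "\<guillemotleft>gcomp C \<G> g0 b : P \<rightarrow> Arrs \<G>\<guillemotright>" "src \<G> \<cdot> f0 = tgt \<G> \<cdot> gcomp C \<G> g0 b"
    using gcomp_hom[OF g0 b e2] e1 by auto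
  have "gcomp C \<H> (gcomp C \<H> f g) h = TA C (gcomp C \<G> (gcomp C \<G> f0 g0) b) \<cdot> u"
    using T_gcomp_element[OF f0 g0 e1 u(1)] T_gcomp_element[OF c1(1) b c1(2) u(1)] fu gu u(3)
    by (simp add: \<H>_def)
  also have "\<dots> = TA C (gcomp C \<G> f0 (gcomp C \<G> g0 b)) \<cdot> u"
    using gcomp_assoc[OF f0 g0 b e1 e2] by simp
  also have "\<dots> = gcomp C \<H> f (gcomp C \<H> g h)"
    using T_gcomp_element[OF g0 b e2 u(1)] T_gcomp_element[OF f0 c2 u(1)] fu gu u(3)
    by (simp add: \<H>_def)
  finally show ?thesis .
qed

lemma Arrs_ob: "Arrs \<G> \<in> Ob C" and Objs_ob: "Objs \<G> \<in> Ob C" and Cps_ob: "Cps \<G> \<in> Ob C"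
  using hom_ob[OF src_hom] hom_ob[OF cmp_hom] by auto

text \<open>\<open>T(G)\<close> again satisfies the hypotheses on composable pairs and triples, so the construction
  iterates to \<open>T\<^sup>2(G)\<close>. The unit and inverse laws involve a single arrow and come from
  \<open>T_gcomp_element\<close> at the universal arrow \<open>\<one> G\<close>.\<close>

lemma tangent_groupoid_T_groupoid: "tangent_groupoid C (T_groupoid C \<G>)"
proof -
  let ?TG = "TO C (Arrs \<G>)"
  have i: "\<guillemotleft>\<one> (Arrs \<G>) : Arrs \<G> \<rightarrow> Arrs \<G>\<guillemotright>" by (rule id_hom[OF Arrs_ob])
  have Ti: "TA C (\<one> (Arrs \<G>)) \<cdot> g = g" if "\<guillemotleft>g : X \<rightarrow> ?TG\<guillemotright>" for g X
    using that T_id[OF Arrs_ob] id_left by simp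
  note id = id_right[OF src_hom] id_right[OF tgt_hom] id_right[OF ginv_hom]
  have te: "\<guillemotleft>unt \<G> \<cdot> tgt \<G> : Arrs \<G> \<rightarrow> Arrs \<G>\<guillemotright>" and se: "\<guillemotleft>unt \<G> \<cdot> src \<G> : Arrs \<G> \<rightarrow> Arrs \<G>\<guillemotright>"
    using comp_hom[OF tgt_hom unt_hom] comp_hom[OF src_hom unt_hom] by auto
  have Tte: "TA C (unt \<G> \<cdot> tgt \<G>) \<cdot> g = TA C (unt \<G>) \<cdot> TA C (tgt \<G>) \<cdot> g"
    and Tse: "TA C (unt \<G> \<cdot> src \<G>) \<cdot> g = TA C (unt \<G>) \<cdot> TA C (src \<G>) \<cdot> g"
    if "\<guillemotleft>g : X \<rightarrow> ?TG\<guillemotright>" for g X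
    using T_comp[OF tgt_hom unt_hom] comp_assoc[OF that T_hom[OF tgt_hom] T_hom[OF unt_hom]]
      T_comp[OF src_hom unt_hom] comp_assoc[OF that T_hom[OF src_hom] T_hom[OF unt_hom]]
    by simp_all
  have ste: "src \<G> \<cdot> unt \<G> \<cdot> tgt \<G> = tgt \<G> \<cdot> \<one> (Arrs \<G>)"
    and tse: "src \<G> \<cdot> \<one> (Arrs \<G>) = tgt \<G> \<cdot> unt \<G> \<cdot> src \<G>"
    using whisker_id[OF src_unt unt_hom src_hom tgt_hom] whisker_id[OF tgt_unt unt_hom tgt_hom src_hom]
      id by auto
  have sg: "src \<G> \<cdot> ginv \<G> = tgt \<G> \<cdot> \<one> (Arrs \<G>)" and tg: "src \<G> \<cdot> \<one> (Arrs \<G>) = tgt \<G> \<cdot> ginv \<G>"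
    using src_ginv tgt_ginv id by auto
  have u_left: "gcomp C (T_groupoid C \<G>) (TA C (unt \<G>) \<cdot> TA C (tgt \<G>) \<cdot> g) g = g"
    and u_right: "gcomp C (T_groupoid C \<G>) g (TA C (unt \<G>) \<cdot> TA C (src \<G>) \<cdot> g) = g"
    and i_left: "gcomp C (T_groupoid C \<G>) (TA C (ginv \<G>) \<cdot> g) g = TA C (unt \<G>) \<cdot> TA C (src \<G>) \<cdot> g"
    and i_right: "gcomp C (T_groupoid C \<G>) g (TA C (ginv \<G>) \<cdot> g) = TA C (unt \<G>) \<cdot> TA C (tgt \<G>) \<cdot> g"
    if g: "\<guillemotleft>g : X \<rightarrow> ?TG\<guillemotright>" for g X
    using T_gcomp_element[OF te i ste g] gcomp_unt_left[OF i]
      T_gcomp_element[OF i se tse g] gcomp_unt_right[OF i]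
      T_gcomp_element[OF ginv_hom i sg g] gcomp_ginv_left[OF i]
      T_gcomp_element[OF i ginv_hom tg g] gcomp_ginv_right[OF i]
      Ti[OF g] Tte[OF g] Tse[OF g] id by simp_all
  have "internal_groupoid C (T_groupoid C \<G>)"
  proof (unfold_locales, unfold T_groupoid_def groupoid.simps)
    show "TA C (src \<G>) \<cdot> TA C (unt \<G>) = \<one> (TO C (Objs \<G>))"
      "TA C (tgt \<G>) \<cdot> TA C (unt \<G>) = \<one> (TO C (Objs \<G>))"
      "TA C (src \<G>) \<cdot> TA C (cmp \<G>) = TA C (src \<G>) \<cdot> TA C (csnd \<G>)"
      "TA C (tgt \<G>) \<cdot> TA C (cmp \<G>) = TA C (tgt \<G>) \<cdot> TA C (cfst \<G>)"
      "TA C (src \<G>) \<cdot> TA C (ginv \<G>) = TA C (tgt \<G>)"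
      "TA C (tgt \<G>) \<cdot> TA C (ginv \<G>) = TA C (src \<G>)"
      using T_comp[OF unt_hom src_hom] T_comp[OF unt_hom tgt_hom] T_comp[OF cmp_hom src_hom]
        T_comp[OF csnd_hom src_hom] T_comp[OF cmp_hom tgt_hom] T_comp[OF cfst_hom tgt_hom]
        T_comp[OF ginv_hom src_hom] T_comp[OF ginv_hom tgt_hom]
        src_unt tgt_unt src_cmp tgt_cmp src_ginv tgt_ginv T_id[OF Objs_ob] by simp_all
  qed (use T_hom[OF src_hom] T_hom[OF tgt_hom] T_hom[OF unt_hom] T_hom[OF ginv_hom]
      T_hom[OF cmp_hom] T_Cps_pullback T_gcomp_assoc u_left u_right i_left i_right
      in \<open>simp_all add: T_groupoid_def\<close>)
  moreover have "T_pullback C (TA C (src \<G>)) (TA C (tgt \<G>)) (TO C (Cps \<G>))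
      (TA C (cfst \<G>)) (TA C (csnd \<G>))"
    by (rule T_pullback_shift[OF T_pairs])
  moreover have "\<exists>P a b. T_pullback C (TA C (src \<G>) \<cdot> TA C (csnd \<G>)) (TA C (tgt \<G>)) P a b"
    using T_triples T_pullback_shift T_comp[OF csnd_hom src_hom] by metis
  ultimately show ?thesis
    by (intro tangent_groupoid.intro tangent_groupoid_axioms.intro
        tangent_category_with_negatives_axioms)
      (simp_all add: T_groupoid_def)
qed

end

section \<open>The values of \<open>\<alpha>\<close>\<close>

context tangent_category
begin

lemma p_zero: "M \<in> Ob C \<Longrightarrow> tp C M \<cdot> tz C M = \<one> M"
  using tangent_additive by (simp add: additive_bundle_def tangent_bundle_def)

text \<open>The additive bundle morphism \<open>(c, id)\<close> gives \<open>p c = T(p)\<close> and \<open>c T(0) = 0\<close>; as \<open>c\<close> is an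
  involution, also \<open>T(p) c = p\<close> and \<open>c 0 = T(0)\<close>.\<close>

lemma Tp_c: "M \<in> Ob C \<Longrightarrow> TA C (tp C M) \<cdot> tc C M = tp C (TO C M)"
  and c_zero: "M \<in> Ob C \<Longrightarrow> tc C M \<cdot> tz C (TO C M) = TA C (tz C M)"
  and c_Tzero: "M \<in> Ob C \<Longrightarrow> tc C M \<cdot> TA C (tz C M) = tz C (TO C M)"
proof -
  assume M: "M \<in> Ob C"
  note add = c_additive[OF M, unfolded additive_bundle_morphism_def tangent_bundle_def
      T_bundle_def, simplified]
  note h = c_hom[OF M] p_hom[OF T_ob[OF M]] T_hom[OF p_hom[OF M]] zero_hom[OF T_ob[OF M]]
    T_hom[OF zero_hom[OF M]]
  have pc: "tp C (TO C M) \<cdot> tc C M = TA C (tp C M)"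
    using add id_left[OF h(3)] by simp
  show cz: "tc C M \<cdot> TA C (tz C M) = tz C (TO C M)"
    using add id_right[OF h(4)] by simp
  show "TA C (tp C M) \<cdot> tc C M = tp C (TO C M)"
    using comp_assoc[OF h(1,1,2)] id_right[OF h(2)] c_c[OF M] pc by simp
  show "tc C M \<cdot> tz C (TO C M) = TA C (tz C M)"
    using comp_assoc[OF h(5,1,1)] id_left[OF h(5)] c_c[OF M] cz by simp
qed

end

context tangent_groupoid
begin

text \<open>\<open>T(p)\<close> is a functor from \<open>T\<^sup>2(G)\<close> to \<open>T(G)\<close>.\<close>

lemma T_p_gcomp:
  assumes g: "\<guillemotleft>g : X \<rightarrow> TO C (TO C (Arrs \<G>))\<guillemotright>" and h: "\<guillemotleft>h : X \<rightarrow> TO C (TO C (Arrs \<G>))\<guillemotright>"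
    and eq: "TA C (TA C (src \<G>)) \<cdot> g = TA C (TA C (tgt \<G>)) \<cdot> h"
  defines "\<H> \<equiv> T_groupoid C \<G>"
  shows "TA C (tp C (Arrs \<G>)) \<cdot> gcomp C (T_groupoid C \<H>) g h =
    gcomp C \<H> (TA C (tp C (Arrs \<G>)) \<cdot> g) (TA C (tp C (Arrs \<G>)) \<cdot> h)"
proof -
  interpret H: tangent_groupoid C \<H> unfolding \<H>_def by (rule tangent_groupoid_T_groupoid)
  interpret HH: tangent_groupoid C "T_groupoid C \<H>" by (rule H.tangent_groupoid_T_groupoid)
  have nat: "TA C f \<cdot> TA C (tp C X) = TA C (tp C Y) \<cdot> TA C (TA C f)"
    if f: "\<guillemotleft>f : X \<rightarrow> Y\<guillemotright>" for f X Y
    using T_comp[OF p_hom[OF hom_ob(1)[OF f]] f] T_comp[OF T_hom[OF f] p_hom[OF hom_ob(2)[OF f]]]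
      p_nat[OF f] by simp
  show ?thesis
    by (rule HH.functor_gcomp[OF H.internal_groupoid_axioms, where ?F2.0 = "TA C (tp C (Cps \<G>))"])
      (use T_hom[OF p_hom[OF Arrs_ob]] T_hom[OF p_hom[OF Cps_ob]] nat[OF cfst_hom] nat[OF csnd_hom]
        nat[OF cmp_hom] g h eq in \<open>simp_all add: \<H>_def T_groupoid_def\<close>)
qed

text \<open>The last two conclusions are the equations that cut \<open>T(A)\<close> out of \<open>T\<^sup>2(G)\<close>, over the base
  point \<open>y\<close>. The hypotheses \<open>pv\<close> and \<open>sv\<close> say that \<open>v\<close> lies in \<open>A\<close> over \<open>m\<close>; \<open>Tsw\<close> combines
  the condition on \<open>T\<^sup>2(s) w\<close> with the equation \<open>T(\<pi>) w = \<rho> v\<close> of the prolongation.\<close>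

lemma alpha_values:
  assumes v: "\<guillemotleft>v : X \<rightarrow> TO C (Arrs \<G>)\<guillemotright>" and w: "\<guillemotleft>w : X \<rightarrow> TO C (TO C (Arrs \<G>))\<guillemotright>"
    and m: "\<guillemotleft>m : X \<rightarrow> Objs \<G>\<guillemotright>"
    and pv: "tp C (Arrs \<G>) \<cdot> v = unt \<G> \<cdot> m" and sv: "TA C (src \<G>) \<cdot> v = tz C (Objs \<G>) \<cdot> m"
    and Tsw: "TA C (TA C (src \<G>)) \<cdot> w = TA C (tz C (Objs \<G>)) \<cdot> TA C (tgt \<G>) \<cdot> v"
  defines "y \<equiv> TA C (tgt \<G>) \<cdot> tp C (TO C (Arrs \<G>)) \<cdot> w"
  shows "\<guillemotleft>alpha C \<G> v w : X \<rightarrow> TO C (TO C (Arrs \<G>))\<guillemotright>"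
    and "TA C (tp C (Arrs \<G>)) \<cdot> alpha C \<G> v w = TA C (unt \<G>) \<cdot> y"
    and "TA C (TA C (src \<G>)) \<cdot> alpha C \<G> v w = TA C (tz C (Objs \<G>)) \<cdot> y"
proof -
  define G M where "G = Arrs \<G>" and "M = Objs \<G>"
  define \<H> where "\<H> = T_groupoid C \<G>"
  define \<K> where "\<K> = T_groupoid C \<H>"
  interpret H: tangent_groupoid C \<H> unfolding \<H>_def by (rule tangent_groupoid_T_groupoid)
  interpret K: tangent_groupoid C \<K> unfolding \<K>_def by (rule H.tangent_groupoid_T_groupoid)
  have Ksel: "Arrs \<K> = TO C (TO C G)" "src \<K> = TA C (TA C (src \<G>))"
    "tgt \<K> = TA C (TA C (tgt \<G>))" "ginv \<K> = TA C (TA C (ginv \<G>))"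
    and Hsel: "Arrs \<H> = TO C G" "src \<H> = TA C (src \<G>)"
    "tgt \<H> = TA C (tgt \<G>)" "ginv \<H> = TA C (ginv \<G>)" "unt \<H> = TA C (unt \<G>)"
    by (simp_all add: \<K>_def \<H>_def T_groupoid_def G_def)
  have ob: "G \<in> Ob C" "M \<in> Ob C" "TO C G \<in> Ob C" "TO C M \<in> Ob C"
    using Arrs_ob Objs_ob T_ob by (simp_all add: G_def M_def)
  have s: "\<guillemotleft>src \<G> : G \<rightarrow> M\<guillemotright>" and t: "\<guillemotleft>tgt \<G> : G \<rightarrow> M\<guillemotright>" and e: "\<guillemotleft>unt \<G> : M \<rightarrow> G\<guillemotright>"
    and i: "\<guillemotleft>ginv \<G> : G \<rightarrow> G\<guillemotright>"
    using src_hom tgt_hom unt_hom ginv_hom by (simp_all add: G_def M_def)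
  note Ts = T_hom[OF s] and Tt = T_hom[OF t] and Te = T_hom[OF e]
  note TTs = T_hom[OF Ts] and TTt = T_hom[OF Tt]
  note v = v[folded G_def] and w = w[folded G_def] and m = m[folded M_def]
    and pv = pv[folded G_def] and sv = sv[folded M_def] and Tsw = Tsw[folded M_def]
  define a b d where "a = tc C G \<cdot> w" and "b = tz C (TO C G) \<cdot> v"
    and "d = tc C G \<cdot> tz C (TO C G) \<cdot> tp C (TO C G) \<cdot> w"
  define k where "k = tp C (TO C G) \<cdot> w"
  have k: "\<guillemotleft>k : X \<rightarrow> TO C G\<guillemotright>" unfolding k_def by (rule comp_hom[OF w p_hom[OF ob(3)]])
  have zk: "\<guillemotleft>tz C (TO C G) \<cdot> k : X \<rightarrow> TO C (TO C G)\<guillemotright>" by (rule comp_hom[OF k zero_hom[OF ob(3)]])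
  have a: "\<guillemotleft>a : X \<rightarrow> TO C (TO C G)\<guillemotright>" unfolding a_def by (rule comp_hom[OF w c_hom[OF ob(1)]])
  have b: "\<guillemotleft>b : X \<rightarrow> TO C (TO C G)\<guillemotright>" unfolding b_def by (rule comp_hom[OF v zero_hom[OF ob(3)]])
  have d_k: "d = tc C G \<cdot> tz C (TO C G) \<cdot> k" by (simp add: d_def k_def)
  have d: "\<guillemotleft>d : X \<rightarrow> TO C (TO C G)\<guillemotright>" unfolding d_k by (rule comp_hom[OF zk c_hom[OF ob(1)]])
  have id: "\<guillemotleft>ginv \<K> \<cdot> d : X \<rightarrow> TO C (TO C G)\<guillemotright>"
    unfolding Ksel by (rule comp_hom[OF d T_hom[OF T_hom[OF i]]])
  have tv: "\<guillemotleft>TA C (tgt \<G>) \<cdot> v : X \<rightarrow> TO C M\<guillemotright>" by (rule comp_hom[OF v Tt])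
  have zm: "\<guillemotleft>tz C M \<cdot> m : X \<rightarrow> TO C M\<guillemotright>" by (rule comp_hom[OF m zero_hom[OF ob(2)]])
  have y_k: "y = TA C (tgt \<G>) \<cdot> k" unfolding y_def k_def G_def ..

  \<comment> \<open>sources and targets of the three factors\<close>
  have d_src_tgt: "TA C (TA C f) \<cdot> d = TA C (tz C M) \<cdot> TA C f \<cdot> k" if f: "\<guillemotleft>f : G \<rightarrow> M\<guillemotright>" for f
  proof -
    have "TA C (TA C f) \<cdot> d = tc C M \<cdot> TA C (TA C f) \<cdot> tz C (TO C G) \<cdot> k"
      unfolding d_k using whisker[OF c_nat[OF f] T_hom[OF T_hom[OF f]] c_hom[OF ob(2)]
          c_hom[OF ob(1)] T_hom[OF T_hom[OF f]] zk] by simp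
    also have "TA C (TA C f) \<cdot> tz C (TO C G) \<cdot> k = tz C (TO C M) \<cdot> TA C f \<cdot> k"
      using whisker[OF zero_nat[OF T_hom[OF f]] T_hom[OF f] zero_hom[OF ob(4)] zero_hom[OF ob(3)]
          T_hom[OF T_hom[OF f]] k] by simp
    also have "tc C M \<cdot> tz C (TO C M) \<cdot> TA C f \<cdot> k = TA C (tz C M) \<cdot> TA C f \<cdot> k"
      by (rule whisker1[OF c_zero[OF ob(2)] zero_hom[OF ob(4)] c_hom[OF ob(2)]
            comp_hom[OF k T_hom[OF f]]])
    finally show ?thesis .
  qed
  have b_src_tgt: "TA C (TA C f) \<cdot> b = tz C (TO C M) \<cdot> TA C f \<cdot> v" if f: "\<guillemotleft>f : G \<rightarrow> M\<guillemotright>" for f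
    unfolding b_def
    using whisker[OF zero_nat[OF T_hom[OF f]] T_hom[OF f] zero_hom[OF ob(4)] zero_hom[OF ob(3)]
        T_hom[OF T_hom[OF f]] v] by simp
  have src_a: "src \<K> \<cdot> a = tz C (TO C M) \<cdot> TA C (tgt \<G>) \<cdot> v"
  proof -
    have "src \<K> \<cdot> a = tc C M \<cdot> TA C (TA C (src \<G>)) \<cdot> w"
      unfolding a_def Ksel
      using whisker[OF c_nat[OF s] TTs c_hom[OF ob(2)] c_hom[OF ob(1)] TTs w] by simp
    also have "\<dots> = tz C (TO C M) \<cdot> TA C (tgt \<G>) \<cdot> v"
      unfolding Tsw by (rule whisker1[OF c_Tzero[OF ob(2)] T_hom[OF zero_hom[OF ob(2)]]
            c_hom[OF ob(2)] tv])
    finally show ?thesis .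
  qed
  have ab: "src \<K> \<cdot> a = tgt \<K> \<cdot> b" using src_a b_src_tgt[OF t] by (simp add: Ksel)
  \<comment> \<open>\<open>T(s) p w = p T\<^sup>2(s) w = p T(0) T(t) v = 0 p T(t) v = 0 t p v = 0 t e m = 0 m\<close>\<close>
  have sk: "TA C (src \<G>) \<cdot> k = tz C M \<cdot> m"
  proof -
    have "TA C (src \<G>) \<cdot> k = tp C (TO C M) \<cdot> TA C (TA C (src \<G>)) \<cdot> w"
      unfolding k_def
      using whisker[OF p_nat[OF Ts] TTs p_hom[OF ob(4)] p_hom[OF ob(3)] Ts w] by simp
    also have "\<dots> = tz C M \<cdot> tp C M \<cdot> TA C (tgt \<G>) \<cdot> v"
      unfolding Tsw by (rule whisker[OF p_nat[OF zero_hom[OF ob(2)]] T_hom[OF zero_hom[OF ob(2)]]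
            p_hom[OF ob(4)] p_hom[OF ob(2)] zero_hom[OF ob(2)] tv])
    also have "tp C M \<cdot> TA C (tgt \<G>) \<cdot> v = tgt \<G> \<cdot> unt \<G> \<cdot> m"
      using whisker[OF p_nat[OF t] Tt p_hom[OF ob(2)] p_hom[OF ob(1)] t v] pv by simp
    also have "\<dots> = m" by (rule whisker_id[OF tgt_unt[folded M_def] e t m])
    finally show ?thesis .
  qed
  have sb: "src \<K> \<cdot> b = TA C (tz C M) \<cdot> tz C M \<cdot> m"
    using b_src_tgt[OF s] sv whisker[OF zero_nat[OF zero_hom[OF ob(2)]] zero_hom[OF ob(2)]
        zero_hom[OF ob(4)] zero_hom[OF ob(2)] T_hom[OF zero_hom[OF ob(2)]] m]
    by (simp add: Ksel)
  have src_ab: "src \<K> \<cdot> gcomp C \<K> a b = tgt \<K> \<cdot> ginv \<K> \<cdot> d"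
  proof -
    have "tgt \<K> \<cdot> ginv \<K> \<cdot> d = src \<K> \<cdot> d"
      using whisker1[OF K.tgt_ginv K.ginv_hom K.tgt_hom] d by (simp add: Ksel)
    also have "\<dots> = TA C (tz C M) \<cdot> tz C M \<cdot> m"
      using d_src_tgt[OF s] sk by (simp add: Ksel)
    finally show ?thesis
      using K.src_gcomp[of a X b] a b ab sb by (simp add: Ksel)
  qed
  have ab_hom: "\<guillemotleft>gcomp C \<K> a b : X \<rightarrow> TO C (TO C G)\<guillemotright>"
    using K.gcomp_hom[of a X b] a b ab by (simp add: Ksel)
  have alpha: "alpha C \<G> v w = gcomp C \<K> (gcomp C \<K> a b) (ginv \<K> \<cdot> d)"
    unfolding alpha_def Let_def a_def b_def d_def \<K>_def \<H>_def G_def ..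
  show "\<guillemotleft>alpha C \<G> v w : X \<rightarrow> TO C (TO C (Arrs \<G>))\<guillemotright>"
    using K.gcomp_hom[of "gcomp C \<K> a b" X "ginv \<K> \<cdot> d"] ab_hom id src_ab
    by (simp add: alpha Ksel flip: G_def)

  have "src \<K> \<cdot> alpha C \<G> v w = src \<K> \<cdot> ginv \<K> \<cdot> d"
    unfolding alpha using K.src_gcomp[of "gcomp C \<K> a b" X "ginv \<K> \<cdot> d"] ab_hom id src_ab
    by (simp add: Ksel)
  also have "\<dots> = tgt \<K> \<cdot> d"
    using whisker1[OF K.src_ginv K.ginv_hom K.src_hom] d by (simp add: Ksel)
  finally show "TA C (TA C (src \<G>)) \<cdot> alpha C \<G> v w = TA C (tz C (Objs \<G>)) \<cdot> y"
    using d_src_tgt[OF t] by (simp add: Ksel y_k M_def)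

  \<comment> \<open>\<open>T(p)\<close> sends \<open>c w\<close> to \<open>p w\<close>, \<open>0 v\<close> to an identity arrow and \<open>c 0 p w\<close> to \<open>p w\<close>.\<close>
  have Tp: "\<guillemotleft>TA C (tp C G) : TO C (TO C G) \<rightarrow> TO C G\<guillemotright>" by (rule T_hom[OF p_hom[OF ob(1)]])
  have pa: "TA C (tp C G) \<cdot> a = k"
    unfolding a_def k_def by (rule whisker1[OF Tp_c[OF ob(1)] c_hom[OF ob(1)] Tp w])
  have pd: "TA C (tp C G) \<cdot> d = k"
    unfolding d_k
    using whisker1[OF Tp_c[OF ob(1)] c_hom[OF ob(1)] Tp zk]
      whisker_id[OF p_zero[OF ob(3)] zero_hom[OF ob(3)] p_hom[OF ob(3)] k] by simp
  have pb: "TA C (tp C G) \<cdot> b = unt \<H> \<cdot> src \<H> \<cdot> k"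
  proof -
    have "TA C (tp C G) \<cdot> b = tz C G \<cdot> tp C G \<cdot> v"
      unfolding b_def
      using whisker[OF zero_nat[OF p_hom[OF ob(1)]] p_hom[OF ob(1)] zero_hom[OF ob(1)]
          zero_hom[OF ob(3)] Tp v] by simp
    also have "\<dots> = TA C (unt \<G>) \<cdot> tz C M \<cdot> m"
      unfolding pv by (rule whisker[OF zero_nat[OF e] e zero_hom[OF ob(1)] zero_hom[OF ob(2)] Te m])
    finally show ?thesis using sk by (simp add: Hsel)
  qed
  have pid: "TA C (tp C G) \<cdot> ginv \<K> \<cdot> d = ginv \<H> \<cdot> k"
  proof -
    have "TA C (tp C G) \<cdot> TA C (TA C (ginv \<G>)) = TA C (ginv \<G>) \<cdot> TA C (tp C G)"
      using T_comp[OF T_hom[OF i] p_hom[OF ob(1)]] T_comp[OF p_hom[OF ob(1)] i] p_nat[OF i] by simp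
    from whisker[OF this T_hom[OF T_hom[OF i]] Tp Tp T_hom[OF i] d] pd
    show ?thesis by (simp add: Ksel Hsel)
  qed
  have "TA C (tp C G) \<cdot> alpha C \<G> v w =
      gcomp C \<H> (gcomp C \<H> k (unt \<H> \<cdot> src \<H> \<cdot> k)) (ginv \<H> \<cdot> k)"
    unfolding alpha
    using T_p_gcomp[of "gcomp C \<K> a b" X "ginv \<K> \<cdot> d"] T_p_gcomp[of a X b]
      ab_hom id src_ab a b ab pa pb pid
    by (simp add: Ksel flip: \<H>_def \<K>_def G_def)
  also have "\<dots> = unt \<H> \<cdot> tgt \<H> \<cdot> k"
    using H.gcomp_unt_right[of k X] H.gcomp_ginv_right[of k X] k by (simp add: Hsel)
  finally show "TA C (tp C (Arrs \<G>)) \<cdot> alpha C \<G> v w = TA C (unt \<G>) \<cdot> y"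
    by (simp add: Hsel y_k G_def)
qed

end

context associated_anchored_bundle
begin

lemma anchored_inclusion:
  shows "\<guillemotleft>\<iota> : Tot E \<rightarrow> TO C (Arrs \<G>)\<guillemotright>" and "\<guillemotleft>Prj E : Tot E \<rightarrow> Objs \<G>\<guillemotright>"
    and "tp C (Arrs \<G>) \<cdot> \<iota> = unt \<G> \<cdot> Prj E"
    and "TA C (src \<G>) \<cdot> \<iota> = tz C (Objs \<G>) \<cdot> Prj E"
proof -
  have pr: "is_product C (Arrs \<G>) (TO C (Objs \<G>)) Q q1 q2"
    using Q_product[unfolded T_product_def, rule_format, of 0] by simp
  note F = product_pair[OF pr p_hom[OF Arrs_ob] T_hom[OF src_hom]]
    and S = product_pair[OF pr unt_hom zero_hom[OF Objs_ob]]
  have q: "\<guillemotleft>q1 : Q \<rightarrow> Arrs \<G>\<guillemotright>" "\<guillemotleft>q2 : Q \<rightarrow> TO C (Objs \<G>)\<guillemotright>"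
    using pr by (auto simp: is_product_def)
  note D = is_pullbackD[OF T_pullback_level(1)[OF E_pullback]]
  show i: "\<guillemotleft>\<iota> : Tot E \<rightarrow> TO C (Arrs \<G>)\<guillemotright>" and p: "\<guillemotleft>Prj E : Tot E \<rightarrow> Objs \<G>\<guillemotright>"
    using D(3,4) F(1) S(1) by (simp_all add: in_hom_def)
  show "tp C (Arrs \<G>) \<cdot> \<iota> = unt \<G> \<cdot> Prj E" "TA C (src \<G>) \<cdot> \<iota> = tz C (Objs \<G>) \<cdot> Prj E"
    using comp_assoc[OF i F(1) q(1)] comp_assoc[OF i F(1) q(2)]
      comp_assoc[OF p S(1) q(1)] comp_assoc[OF p S(1) q(2)] D(5) F(2,3) S(2,3) by simp_all
qed

text \<open>As \<open>T\<close> preserves the pullback defining \<open>A\<close> and the product used to state it, an element of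
  \<open>T\<^sup>2(G)\<close> lies in \<open>T(A)\<close> as soon as it satisfies the two equations.\<close>

lemma factor_through_T_anchored:
  assumes u: "\<guillemotleft>u : X \<rightarrow> TO C (TO C (Arrs \<G>))\<guillemotright>" and y: "\<guillemotleft>y : X \<rightarrow> TO C (Objs \<G>)\<guillemotright>"
    and pu: "TA C (tp C (Arrs \<G>)) \<cdot> u = TA C (unt \<G>) \<cdot> y"
    and su: "TA C (TA C (src \<G>)) \<cdot> u = TA C (tz C (Objs \<G>)) \<cdot> y"
  shows "\<exists>\<beta>. \<guillemotleft>\<beta> : X \<rightarrow> TO C (Tot E)\<guillemotright> \<and> TA C \<iota> \<cdot> \<beta> = u"
proof -
  have pr: "is_product C (Arrs \<G>) (TO C (Objs \<G>)) Q q1 q2"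
    and Tpr: "is_product C (TO C (Arrs \<G>)) (TO C (TO C (Objs \<G>))) (TO C Q) (TA C q1) (TA C q2)"
    using Q_product[unfolded T_product_def, rule_format, of 0]
      Q_product[unfolded T_product_def, rule_format, of 1] by simp_all
  define f g where "f = pair C q1 q2 (tp C (Arrs \<G>)) (TA C (src \<G>))"
    and "g = pair C q1 q2 (unt \<G>) (tz C (Objs \<G>))"
  note F = product_pair[OF pr p_hom[OF Arrs_ob] T_hom[OF src_hom], folded f_def]
    and S = product_pair[OF pr unt_hom zero_hom[OF Objs_ob], folded g_def]
  note TF = T_hom[OF F(1)] and TS = T_hom[OF S(1)]
  have q: "\<guillemotleft>q1 : Q \<rightarrow> Arrs \<G>\<guillemotright>" "\<guillemotleft>q2 : Q \<rightarrow> TO C (Objs \<G>)\<guillemotright>"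
    using pr by (auto simp: is_product_def)
  have "TA C f \<cdot> u = TA C g \<cdot> y"
  proof (rule product_joint_mono[OF Tpr comp_hom[OF u TF] comp_hom[OF y TS]])
    show "TA C q1 \<cdot> TA C f \<cdot> u = TA C q1 \<cdot> TA C g \<cdot> y"
      using comp_assoc[OF u TF T_hom[OF q(1)]] comp_assoc[OF y TS T_hom[OF q(1)]]
        T_comp[OF F(1) q(1)] T_comp[OF S(1) q(1)] F(2) S(2) pu by simp
    show "TA C q2 \<cdot> TA C f \<cdot> u = TA C q2 \<cdot> TA C g \<cdot> y"
      using comp_assoc[OF u TF T_hom[OF q(2)]] comp_assoc[OF y TS T_hom[OF q(2)]]
        T_comp[OF F(1) q(2)] T_comp[OF S(1) q(2)] F(3) S(3) su by simp
  qed
  then show ?thesis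
    using pullback_factor[OF T_pullback_level(2)[OF E_pullback, folded f_def g_def], of u X y]
      u y TF TS by (auto simp: in_hom_def)
qed

end

theorem lemma3p3p0p5:
  fixes C :: "('o, 'a, 'z) tangent_scheme" and \<G> :: "('o, 'a) groupoid"
    and E :: "('o, 'a) anchored_bundle"
    and \<iota> v w q1 q2 :: 'a and Q P :: 'o
  assumes "associated_anchored_bundle C \<G> E \<iota> Q q1 q2"
    and "T_pullback C (Anc E) (TA C (Prj E)) P v w"
  shows "\<exists>\<beta>. \<guillemotleft>\<beta> : P \<rightarrow>\<^bsub>C\<^esub> TO C (Tot E)\<guillemotright> \<and>
    TA C \<iota> \<cdot>\<^bsub>C\<^esub> \<beta> = alpha C \<G> (\<iota> \<cdot>\<^bsub>C\<^esub> v) (TA C \<iota> \<cdot>\<^bsub>C\<^esub> w)"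
proof -
  interpret associated_anchored_bundle C \<G> E \<iota> Q q1 q2 by (rule assms(1))
  note A = anchored_inclusion and D = is_pullbackD[OF T_pullback_level(1)[OF assms(2)]]
  note Ti = T_hom[OF A(1)] and Tp = T_hom[OF A(2)]
  have v: "in_hom C v P (Tot E)" and w: "in_hom C w P (TO C (Tot E))"
    using D(3,4) comp_hom[OF A(1) T_hom[OF tgt_hom]] Tp by (simp_all add: in_hom_def E_anchor)
  define v' w' m where "v' = Comp C \<iota> v" and "w' = Comp C (TA C \<iota>) w" and "m = Comp C (Prj E) v"
  have v': "in_hom C v' P (TO C (Arrs \<G>))" and w': "in_hom C w' P (TO C (TO C (Arrs \<G>)))"
    and m: "in_hom C m P (Objs \<G>)"
    unfolding v'_def w'_def m_def
    using comp_hom[OF v A(1)] comp_hom[OF w Ti] comp_hom[OF v A(2)] by auto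
  have pv: "Comp C (tp C (Arrs \<G>)) v' = Comp C (unt \<G>) m"
    and sv: "Comp C (TA C (src \<G>)) v' = Comp C (tz C (Objs \<G>)) m"
    unfolding v'_def m_def
    using whisker[OF A(3) A(1) p_hom[OF Arrs_ob] A(2) unt_hom v]
      whisker[OF A(4) A(1) T_hom[OF src_hom] A(2) zero_hom[OF Objs_ob] v] by auto
  have "Comp C (TA C (TA C (src \<G>))) (TA C \<iota>) = Comp C (TA C (tz C (Objs \<G>))) (TA C (Prj E))"
    using T_comp[OF A(1) T_hom[OF src_hom]] T_comp[OF A(2) zero_hom[OF Objs_ob]] A(4) by simp
  from whisker[OF this Ti T_hom[OF T_hom[OF src_hom]] Tp T_hom[OF zero_hom[OF Objs_ob]] w]
  have sw: "Comp C (TA C (TA C (src \<G>))) w' =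
      Comp C (TA C (tz C (Objs \<G>))) (Comp C (TA C (tgt \<G>)) v')"
    using D(5) comp_assoc[OF v A(1) T_hom[OF tgt_hom]] by (simp add: w'_def v'_def E_anchor)
  note alpha = alpha_values[OF v' w' m pv sv sw]
  show ?thesis
    using factor_through_T_anchored[OF alpha(1)
        comp_hom[OF comp_hom[OF w' p_hom[OF T_ob[OF Arrs_ob]]] T_hom[OF tgt_hom]] alpha(2,3)]
    by (simp add: v'_def w'_def)
qed

end
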